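(* Let $T$ be an integrable random variable with $T\ge0$ a.s., and let $0<\alpha<1$. Suppose $\{M_k^\mu\}_{k\ge0,\ \mu>0}$ is a decreasing family of test supermartingales for the null hypotheses $H_0:\mathbf{E}(T)\le\mu$ ($\mu>0$), with $M_0^\mu=1$ for all $\mu>0$. For each $k\ge0$ define the statistic $$B_k^l=-\infty\ \text{ if } M_k^\mu<1/\alpha \text{ for all }\mu>0,\qquad B_k^l=\sup\{\mu>0\mid M_k^\mu\ge1/\alpha\}\ \text{ otherwise}.$$ Then $$\mathbb{P}\{\forall k:\ \mathbf{E}(T)>B_k^l\}\ge1-\alpha.$$
   Context: A filtration $\{\mathcal{F}_k\}_{k\ge0}$ is fixed. A process $\{Y_k\}_{k\ge0}$ is a test supermartingale for a hypothesis $H_0$ if, whenever $H_0$ is satisfied, $\{Y_k\}_k$ is a positive (i.e. $Y_k\ge0$ a.s. for each $k$) integrable supermartingale with respect to $\{\mathcal{F}_k\}_k$ with $\mathbf{E}(Y_0)>0$. A decreasing family of test supermartingales for the null hypotheses $\{H_0:\mathbf{E}(T)\le\mu\}_{\mu>0}$ is a family $\{M_k^\mu\}_{k\ge0,\mu>0}$ such that for each $\mu>0$ the process $\{M_k^\mu\}_k$ is a test supermartingale for $H_0:\mathbf{E}(T)\le\mu$, and for every $k$ every realization of $\mu\mapsto M_k^\mu$ is continuous and decreasing (i.e. nonincreasing) on $(0,\infty)$. *)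

theory Defs
  imports "HOL-Probability.Probability"
begin

definition prob_filtration :: "'a measure \<Rightarrow> (nat \<Rightarrow> 'a measure) \<Rightarrow> bool" where
  "prob_filtration M F \<longleftrightarrow> filtration (space M) F \<and> (\<forall>k. subalgebra M (F k))"

definition supermartingale ::
  "'a measure \<Rightarrow> (nat \<Rightarrow> 'a measure) \<Rightarrow> (nat \<Rightarrow> 'a \<Rightarrow> real) \<Rightarrow> bool" where
  "supermartingale M F Y \<longleftrightarrow>
     (\<forall>k. Y k \<in> borel_measurable (F k)) \<and>
     (\<forall>k. integrable M (Y k)) \<and>
     (\<forall>k. AE \<omega> in M. real_cond_exp M (F k) (Y (Suc k)) \<omega> \<le> Y k \<omega>)"

(* H0 is the truth value of the null hypothesis under the probability measure M. When it is
   false, Y is only required to consist of random variables. *)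
definition test_supermartingale ::
  "'a measure \<Rightarrow> (nat \<Rightarrow> 'a measure) \<Rightarrow> bool \<Rightarrow> (nat \<Rightarrow> 'a \<Rightarrow> real) \<Rightarrow> bool" where
  "test_supermartingale M F H0 Y \<longleftrightarrow>
     (\<forall>k. Y k \<in> borel_measurable M) \<and>
     (H0 \<longrightarrow> supermartingale M F Y \<and>
            (\<forall>k. AE \<omega> in M. 0 \<le> Y k \<omega>) \<and>
            0 < integral\<^sup>L M (Y 0))"

(* X \<mu> k is the k-th variable of the process with parameter \<mu>; only the values of X at
   \<mu> > 0 matter. *)
definition decreasing_test_supermartingales ::
  "'a measure \<Rightarrow> (nat \<Rightarrow> 'a measure) \<Rightarrow> ('a \<Rightarrow> real) \<Rightarrow> (real \<Rightarrow> nat \<Rightarrow> 'a \<Rightarrow> real) \<Rightarrow> bool" where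
  "decreasing_test_supermartingales M F T X \<longleftrightarrow>
     (\<forall>\<mu>>0. test_supermartingale M F (integral\<^sup>L M T \<le> \<mu>) (X \<mu>)) \<and>
     (\<forall>k. \<forall>\<omega>\<in>space M. continuous_on {0<..} (\<lambda>\<mu>. X \<mu> k \<omega>) \<and>
                        antimono_on {0<..} (\<lambda>\<mu>. X \<mu> k \<omega>))"

(* The supremum is taken in the extended reals because the set may be unbounded above. *)
definition lower_bound_stat ::
  "real \<Rightarrow> (real \<Rightarrow> nat \<Rightarrow> 'a \<Rightarrow> real) \<Rightarrow> nat \<Rightarrow> 'a \<Rightarrow> ereal" where
  "lower_bound_stat \<alpha> X k \<omega> =
     (if \<forall>\<mu>>0. X \<mu> k \<omega> < 1 / \<alpha> then - \<infinity>
      else (SUP \<mu>\<in>{\<mu>. 0 < \<mu> \<and> 1 / \<alpha> \<le> X \<mu> k \<omega>}. ereal \<mu>))"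

end

(* The event that the bound fails at some time is the event that M_k^\<mu> reaches 1/\<alpha> for some k,
   where \<mu> = E(T) if E(T) > 0 (by continuity the supremum defining B_k^l stays below E(T) as soon as
   M_k^\<mu> < 1/\<alpha> at \<mu> = E(T)).  Ville's inequality bounds its probability by \<alpha>.  If E(T) = 0, that
   event is, by monotonicity in \<mu>, the increasing union over n of the corresponding events for
   \<mu> = 1/(n+1), to each of which Ville's inequality applies. *)
theory Submission
  imports Defs
begin

lemma (in finite_measure) measure_UN_incseq_le:
  assumes "range A \<subseteq> sets M" "incseq A" "\<And>n::nat. measure M (A n) \<le> a"
  shows "measure M (\<Union>n. A n) \<le> a"
  using finite_Lim_measure_incseq[OF assms(1,2)] assms(3) by (intro LIMSEQ_le_const2) auto

text \<open>Over a set of \<open>F n\<close>, \<open>Y (Suc n)\<close> and its conditional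
  expectation given \<open>F n\<close> have the same integral, so the almost sure supermartingale
  inequality can be integrated over \<open>A\<close>.\<close>

lemma (in prob_space) supermartingale_set_integral_Suc_le:
  assumes "prob_filtration M F" "supermartingale M F Y" "A \<in> sets (F n)"
  shows "(\<integral>\<omega>\<in>A. Y (Suc n) \<omega> \<partial>M) \<le> (\<integral>\<omega>\<in>A. Y n \<omega> \<partial>M)"
proof -
  have sub: "subalgebra M (F n)" using assms(1) by (simp add: prob_filtration_def)
  interpret S: finite_measure_subalgebra M "F n" by unfold_locales (rule sub)
  have A: "A \<in> sets M" using sub assms(3) by (auto simp: subalgebra_def)
  have int: "integrable M (Y k)" for k using assms(2) by (simp add: supermartingale_def)
  have "(\<integral>\<omega>\<in>A. Y (Suc n) \<omega> \<partial>M) = (\<integral>\<omega>\<in>A. real_cond_exp M (F n) (Y (Suc n)) \<omega> \<partial>M)"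
    by (rule S.real_cond_exp_intA[OF int assms(3)])
  also have "\<dots> \<le> (\<integral>\<omega>\<in>A. Y n \<omega> \<partial>M)"
    unfolding set_lebesgue_integral_def
  proof (rule integral_mono_AE)
    show "integrable M (\<lambda>\<omega>. indicator A \<omega> *\<^sub>R real_cond_exp M (F n) (Y (Suc n)) \<omega>)"
      using A S.real_cond_exp_int(1)[OF int] by (intro integrable_mult_indicator)
    show "integrable M (\<lambda>\<omega>. indicator A \<omega> *\<^sub>R Y n \<omega>)"
      using A int by (intro integrable_mult_indicator)
    show "AE \<omega> in M. indicator A \<omega> *\<^sub>R real_cond_exp M (F n) (Y (Suc n)) \<omega>
        \<le> indicator A \<omega> *\<^sub>R Y n \<omega>"
    proof -
      have "AE \<omega> in M. real_cond_exp M (F n) (Y (Suc n)) \<omega> \<le> Y n \<omega>"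
        using assms(2) by (simp add: supermartingale_def)
      then show ?thesis by eventually_elim (simp add: indicator_def)
    qed
  qed
  finally show ?thesis .
qed

text \<open>No stopping times are used: the process is replaced by the constant \<open>c\<close>
  from the first time it reaches \<open>c\<close>. At time \<open>n\<close> this frozen process has
  expectation \<open>c * prob (space M - B n)\<close> plus the integral of \<open>Y n\<close> over
  \<open>B n\<close>, and induction bounds this by the expectation of \<open>Y 0\<close>.
  Nonnegativity drops the second term, and \<open>n\<close> then tends to infinity.\<close>

lemma (in prob_space) Ville_inequality:
  assumes filt: "prob_filtration M F" and sm: "supermartingale M F Y"
    and nn: "\<And>k. AE \<omega> in M. 0 \<le> Y k \<omega>" and "0 < c"
  shows "c * prob {\<omega> \<in> space M. \<exists>k. c \<le> Y k \<omega>} \<le> expectation (Y 0)"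
proof -
  define B where "B n = {\<omega> \<in> space M. \<forall>j\<le>n. Y j \<omega> < c}" for n
  have space_F: "space (F n) = space M" for n
    using filt by (simp add: prob_filtration_def subalgebra_def)
  have F_M: "sets (F n) \<subseteq> sets M" for n
    using filt by (simp add: prob_filtration_def subalgebra_def)
  have F_mono: "j \<le> n \<Longrightarrow> sets (F j) \<subseteq> sets (F n)" for j n
    using filt by (auto simp: prob_filtration_def filtration_def)
  have int: "integrable M (Y k)" for k using sm by (simp add: supermartingale_def)
  have [measurable]: "Y k \<in> borel_measurable M" for k
    using int by (rule borel_measurable_integrable)
  have Y_F: "Y j \<in> borel_measurable (F n)" if "j \<le> n" for j n
    using sm F_mono[OF that] by (auto simp: supermartingale_def measurable_def space_F)
  have B_F: "B n \<in> sets (F n)" for n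
  proof -
    have "{\<omega> \<in> space (F n). \<forall>j\<in>{..n}. Y j \<omega> < c} \<in> sets (F n)"
      using Y_F by (intro sets.sets_Collect_finite_All' borel_measurable_less) auto
    then show ?thesis by (simp only: B_def space_F Ball_def atMost_iff)
  qed
  have B[measurable]: "B n \<in> sets M" for n by (rule subsetD[OF F_M B_F])
  have B_Suc: "B (Suc n) = B n \<inter> {\<omega> \<in> space M. Y (Suc n) \<omega> < c}" for n
    by (auto simp: B_def le_Suc_eq)
  have intB: "integrable M (\<lambda>\<omega>. indicator (B n) \<omega> * Y k \<omega>)" for n k
    using integrable_mult_indicator[OF B int] by simp
  have intC: "integrable M (\<lambda>\<omega>. c * indicator (space M - B n) \<omega>)" for n
    by (simp add: emeasure_eq_measure)
  \<comment> \<open>Merging both terms into one expectation lets the induction below compare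
    integrands pointwise.\<close>
  have split: "c * prob (space M - B n) + (\<integral>\<omega>\<in>B n. Y k \<omega> \<partial>M)
      = expectation (\<lambda>\<omega>. c * indicator (space M - B n) \<omega> + indicator (B n) \<omega> * Y k \<omega>)" for n k
  proof -
    have "expectation (\<lambda>\<omega>. c * indicator (space M - B n) \<omega>) = c * prob (space M - B n)"
      by simp
    then show ?thesis
      using Bochner_Integration.integral_add[OF intC intB] by (simp add: set_lebesgue_integral_def)
  qed
  have main: "c * prob (space M - B n) + (\<integral>\<omega>\<in>B n. Y n \<omega> \<partial>M) \<le> expectation (Y 0)" for n
  proof (induction n)
    case 0
    have "c * prob (space M - B 0) + (\<integral>\<omega>\<in>B 0. Y 0 \<omega> \<partial>M)
        = expectation (\<lambda>\<omega>. c * indicator (space M - B 0) \<omega> + indicator (B 0) \<omega> * Y 0 \<omega>)"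
      by (rule split)
    also have "\<dots> \<le> expectation (Y 0)"
      by (intro integral_mono Bochner_Integration.integrable_add int intB intC)
        (auto simp: B_def indicator_def)
    finally show ?case .
  next
    case (Suc n)
    have "c * prob (space M - B (Suc n)) + (\<integral>\<omega>\<in>B (Suc n). Y (Suc n) \<omega> \<partial>M)
        = expectation (\<lambda>\<omega>. c * indicator (space M - B (Suc n)) \<omega>
                            + indicator (B (Suc n)) \<omega> * Y (Suc n) \<omega>)"
      by (rule split)
    \<comment> \<open>The integrands differ only on \<open>B n - B (Suc n)\<close>, where the left
      one is \<open>c\<close> and the right one is \<open>Y (Suc n) \<omega>\<close>, which is at
      least \<open>c\<close> there.\<close>
    also have "\<dots> \<le> expectation (\<lambda>\<omega>. c * indicator (space M - B n) \<omega>
                            + indicator (B n) \<omega> * Y (Suc n) \<omega>)"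
      by (intro integral_mono Bochner_Integration.integrable_add intB intC)
        (auto simp: B_Suc indicator_def)
    also have "\<dots> = c * prob (space M - B n) + (\<integral>\<omega>\<in>B n. Y (Suc n) \<omega> \<partial>M)"
      by (rule split[symmetric])
    also have "\<dots> \<le> c * prob (space M - B n) + (\<integral>\<omega>\<in>B n. Y n \<omega> \<partial>M)"
      using supermartingale_set_integral_Suc_le[OF filt sm B_F] by simp
    finally show ?case using Suc.IH by simp
  qed
  have "c * prob (space M - B n) \<le> expectation (Y 0)" for n
  proof -
    have "0 \<le> (\<integral>\<omega>\<in>B n. Y n \<omega> \<partial>M)"
      unfolding set_lebesgue_integral_def
      using nn[of n] by (intro integral_nonneg_AE) auto
    then show ?thesis using main[of n] by simp
  qed
  \<comment> \<open>The bound is uniform in \<open>n\<close> and the sets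
    \<open>space M - B n\<close> increase, so it passes to their union.\<close>
  then have "prob (\<Union>n. space M - B n) \<le> expectation (Y 0) / c"
    using \<open>0 < c\<close>
    by (intro measure_UN_incseq_le) (auto simp: B_def incseq_def field_simps intro: order_trans)
  moreover have "(\<Union>n. space M - B n) = {\<omega> \<in> space M. \<exists>k. c \<le> Y k \<omega>}"
    unfolding B_def using not_less by blast
  ultimately show ?thesis using \<open>0 < c\<close> by (simp add: field_simps)
qed

lemma lower_bound_stat_upper:
  assumes "0 < \<mu>" "1 / \<alpha> \<le> X \<mu> k \<omega>"
  shows "ereal \<mu> \<le> lower_bound_stat \<alpha> X k \<omega>"
proof -
  have "\<not> (\<forall>\<mu>>0. X \<mu> k \<omega> < 1 / \<alpha>)" using assms not_less by blast
  then show ?thesis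
    using assms unfolding lower_bound_stat_def by (simp only: if_False) (auto intro: SUP_upper)
qed

text \<open>Monotonicity alone would only keep the supremum at most \<open>m\<close>. Continuity at
  \<open>m\<close> makes the inequality strict: the value is still below \<open>1 / \<alpha>\<close>
  at some point left of \<open>m\<close>, and by monotonicity that point bounds the whole
  set.\<close>

lemma lower_bound_stat_less_iff:
  assumes cont: "continuous_on {0<..} (\<lambda>\<mu>. X \<mu> k \<omega>)"
    and anti: "antimono_on {0<..} (\<lambda>\<mu>. X \<mu> k \<omega>)" and "0 < m"
  shows "lower_bound_stat \<alpha> X k \<omega> < ereal m \<longleftrightarrow> X m k \<omega> < 1 / \<alpha>"
proof
  assume "lower_bound_stat \<alpha> X k \<omega> < ereal m"
  then show "X m k \<omega> < 1 / \<alpha>"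
    using lower_bound_stat_upper[of m] \<open>0 < m\<close> by (meson not_less)
next
  assume less: "X m k \<omega> < 1 / \<alpha>"
  have "isCont (\<lambda>\<mu>. X \<mu> k \<omega>) m"
    using cont \<open>0 < m\<close> by (simp add: continuous_on_eq_continuous_at)
  then have "\<forall>\<^sub>F \<mu> in at m. X \<mu> k \<omega> < 1 / \<alpha>"
    using less by (auto simp: isCont_def intro: order_tendstoD)
  then obtain d where d: "0 < d" "\<And>\<mu>. \<mu> \<noteq> m \<Longrightarrow> dist \<mu> m < d \<Longrightarrow> X \<mu> k \<omega> < 1 / \<alpha>"
    by (auto simp: eventually_at)
  \<comment> \<open>The minimum with \<open>m\<close> keeps \<open>m - e\<close> positive, hence in
    the domain of monotonicity; halving keeps \<open>e\<close> strictly below both \<open>d\<close>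
    and \<open>m\<close>.\<close>
  define e where "e = min d m / 2"
  have e: "0 < e" "e < m" "e < d" using d(1) \<open>0 < m\<close> by (auto simp: e_def)
  have X_e: "X (m - e) k \<omega> < 1 / \<alpha>" using d(2)[of "m - e"] e by (simp add: dist_real_def)
  have "\<mu> \<le> m - e" if "0 < \<mu>" "1 / \<alpha> \<le> X \<mu> k \<omega>" for \<mu>
  proof (rule ccontr)
    assume "\<not> \<mu> \<le> m - e"
    then have "X \<mu> k \<omega> \<le> X (m - e) k \<omega>"
      using that e by (intro monotone_onD[OF anti]) auto
    then show False using X_e that by simp
  qed
  then have "lower_bound_stat \<alpha> X k \<omega> \<le> ereal (m - e)"
    by (auto simp: lower_bound_stat_def intro!: SUP_least)
  also have "\<dots> < ereal m" using e by simp
  finally show "lower_bound_stat \<alpha> X k \<omega> < ereal m" .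
qed

text \<open>Substitute for the previous equivalence at 0, which is no parameter of the family. All
  members of the set are positive, so a negative statistic must be \<open>- \<infinity>\<close>.
  Since \<open>1 / real (Suc n)\<close> tends to 0, monotonicity reduces the condition on all \<mu>
  > 0 to countably many parameters.\<close>

lemma lower_bound_stat_less_0_iff:
  assumes anti: "antimono_on {0<..} (\<lambda>\<mu>. X \<mu> k \<omega>)"
  shows "lower_bound_stat \<alpha> X k \<omega> < 0 \<longleftrightarrow> (\<forall>n. X (1 / real (Suc n)) k \<omega> < 1 / \<alpha>)"
proof
  assume less: "lower_bound_stat \<alpha> X k \<omega> < 0"
  have "X \<mu> k \<omega> < 1 / \<alpha>" if "0 < \<mu>" for \<mu>
  proof (rule ccontr)
    assume *: "\<not> X \<mu> k \<omega> < 1 / \<alpha>"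
    then have "ereal \<mu> \<le> lower_bound_stat \<alpha> X k \<omega>"
      using that by (intro lower_bound_stat_upper) auto
    then have "ereal \<mu> < 0" using less by (rule order_le_less_trans)
    then show False using that by (simp add: zero_ereal_def)
  qed
  then show "\<forall>n. X (1 / real (Suc n)) k \<omega> < 1 / \<alpha>" by simp
next
  assume *: "\<forall>n. X (1 / real (Suc n)) k \<omega> < 1 / \<alpha>"
  have "X \<mu> k \<omega> < 1 / \<alpha>" if "0 < \<mu>" for \<mu>
  proof -
    obtain n where "1 / real (Suc n) < \<mu>"
      using reals_Archimedean[OF \<open>0 < \<mu>\<close>] unfolding inverse_eq_divide by blast
    then have "X \<mu> k \<omega> \<le> X (1 / real (Suc n)) k \<omega>"
      using that by (intro monotone_onD[OF anti]) auto
    then show ?thesis using * by (meson le_less_trans)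
  qed
  then show "lower_bound_stat \<alpha> X k \<omega> < 0" by (simp add: lower_bound_stat_def)
qed

theorem theorem10:
  fixes M :: "'a measure"
    and F :: "nat \<Rightarrow> 'a measure"
    and T :: "'a \<Rightarrow> real"
    and X :: "real \<Rightarrow> nat \<Rightarrow> 'a \<Rightarrow> real"
    and \<alpha> :: real
  assumes "prob_space M"
    and "prob_filtration M F"
    and "integrable M T"
    and "AE \<omega> in M. 0 \<le> T \<omega>"
    and "0 < \<alpha>" and "\<alpha> < 1"
    and "decreasing_test_supermartingales M F T X"
    and "\<forall>\<mu>>0. AE \<omega> in M. X \<mu> 0 \<omega> = 1"
  shows "measure M {\<omega> \<in> space M. \<forall>k. ereal (integral\<^sup>L M T) > lower_bound_stat \<alpha> X k \<omega>} \<ge> 1 - \<alpha>"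
proof -
  interpret prob_space M by fact
  define m where "m = expectation T"
  define A where "A \<mu> = {\<omega> \<in> space M. \<exists>k. 1 / \<alpha> \<le> X \<mu> k \<omega>}" for \<mu>
  have "0 \<le> m" unfolding m_def using assms(4) by (rule integral_nonneg_AE)
  have tsm: "test_supermartingale M F (m \<le> \<mu>) (X \<mu>)" if "0 < \<mu>" for \<mu>
    using assms(7) that by (simp add: decreasing_test_supermartingales_def m_def)
  have cont: "continuous_on {0<..} (\<lambda>\<mu>. X \<mu> k \<omega>)"
    and anti: "antimono_on {0<..} (\<lambda>\<mu>. X \<mu> k \<omega>)" if "\<omega> \<in> space M" for k \<omega>
    using assms(7) that by (auto simp: decreasing_test_supermartingales_def)
  have A_sets: "A \<mu> \<in> sets M" if "0 < \<mu>" for \<mu>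
  proof -
    have [measurable]: "X \<mu> k \<in> borel_measurable M" for k
      using tsm[OF that] by (simp add: test_supermartingale_def)
    show ?thesis unfolding A_def by measurable
  qed
  \<comment> \<open>The condition \<open>m \<le> \<mu>\<close> is the null hypothesis for \<mu>, so
    \<open>X \<mu>\<close> is a nonnegative supermartingale. Ville's inequality applies at level
    \<open>1 / \<alpha>\<close>, with initial expectation 1.\<close>
  have A_le: "prob (A \<mu>) \<le> \<alpha>" if "0 < \<mu>" "m \<le> \<mu>" for \<mu>
  proof -
    have "1 / \<alpha> * prob (A \<mu>) \<le> expectation (X \<mu> 0)"
      unfolding A_def using tsm[OF that(1)] that(2) assms(2,5)
      by (intro Ville_inequality[of F]) (auto simp: test_supermartingale_def)
    also have "\<dots> = expectation (\<lambda>_. 1)"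
      using tsm[OF that(1)] that(1) assms(8)
      by (intro integral_cong_AE) (auto simp: test_supermartingale_def)
    finally show ?thesis using assms(5) by (simp add: prob_space field_simps)
  qed
  \<comment> \<open>Since \<open>measure\<close> is 0 on non-measurable sets, the coverage event
    must be shown measurable; exhibiting it as the complement of a set \<open>C\<close> in
    \<open>sets M\<close> does this and allows \<open>prob_compl\<close>.\<close>
  obtain C where C: "C \<in> sets M" "prob C \<le> \<alpha>"
    "{\<omega> \<in> space M. \<forall>k. lower_bound_stat \<alpha> X k \<omega> < ereal m} = space M - C"
  proof (cases "m = 0")
    case False
    then have "0 < m" using \<open>0 \<le> m\<close> by simp
    have "{\<omega> \<in> space M. \<forall>k. lower_bound_stat \<alpha> X k \<omega> < ereal m} = space M - A m"
      using \<open>0 < m\<close>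
      by (auto simp: A_def lower_bound_stat_less_iff cont anti) (meson not_le)+
    then show thesis using that A_sets A_le \<open>0 < m\<close> by blast
  next
    case True
    \<comment> \<open>Each parameter here is positive and exceeds \<open>m = 0\<close>, so
      \<open>A_le\<close> bounds every set of the sequence.\<close>
    let ?A = "\<lambda>n. A (1 / real (Suc n))"
    have "incseq ?A"
    proof (rule incseq_SucI, rule subsetI)
      fix n \<omega> assume "\<omega> \<in> ?A n"
      then obtain k where k: "\<omega> \<in> space M" "1 / \<alpha> \<le> X (1 / real (Suc n)) k \<omega>"
        by (auto simp: A_def)
      moreover have "X (1 / real (Suc n)) k \<omega> \<le> X (1 / real (Suc (Suc n))) k \<omega>"
        by (intro monotone_onD[OF anti[OF k(1)]]) (auto simp: field_simps)
      ultimately show "\<omega> \<in> ?A (Suc n)" unfolding A_def using order_trans by blast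
    qed
    then have "prob (\<Union>n. ?A n) \<le> \<alpha>"
      using A_sets A_le True by (intro measure_UN_incseq_le) auto
    moreover have "(\<Union>n. ?A n) \<in> sets M" using A_sets by (intro sets.countable_UN) auto
    moreover have "{\<omega> \<in> space M. \<forall>k. lower_bound_stat \<alpha> X k \<omega> < ereal m} = space M - (\<Union>n. ?A n)"
    proof -
      have "{\<omega> \<in> space M. \<forall>k. lower_bound_stat \<alpha> X k \<omega> < ereal m}
          = {\<omega> \<in> space M. \<forall>k n. X (1 / real (Suc n)) k \<omega> < 1 / \<alpha>}"
        using lower_bound_stat_less_0_iff[of X, OF anti] True
        by (simp add: zero_ereal_def del: of_nat_Suc cong: conj_cong)
      also have "\<dots> = space M - (\<Union>n. ?A n)"
        unfolding A_def using not_le by blast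
      finally show ?thesis .
    qed
    ultimately show thesis using that by blast
  qed
  then show ?thesis using prob_compl[OF C(1)] by (simp add: m_def)
qed

end
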